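(* Let $\Theta=(\Sigma,\varphi)$ be a connected $\mathbb{T}$-gain graph with a vertex ordering $<$. Then $\Theta$ is balanced if and only if $DL^{\max}_{<}(\Theta)=DL^{\min}_{<}(\Theta)$ and this common matrix $DL(\Theta)$ has the same spectrum as the distance Laplacian matrix $DL(\Sigma)=Tr(\Sigma)-D(\Sigma)$ of the underlying graph $\Sigma$.
   Context: $\mathbb{T}=\{z\in\mathbb{C}:|z|=1\}$. A $\mathbb{T}$-gain graph $\Theta=(\Sigma,\varphi)$: simple finite graph $\Sigma$ with vertices $v_1,\dots,v_n$, $\varphi$ from oriented edges to $\mathbb{T}$ with $\varphi(\vec e_{k,j})=\varphi(\vec e_{j,k})^{-1}$; gain of an oriented path or cycle = product of the gains of its edges in order; $\Theta$ is balanced if every cycle has gain $1$. $d$ is graph distance and $D(\Sigma)=(d(v_s,v_t))$ is the distance matrix of $\Sigma$. For $y<z$, $\varphi^{\max}_{<}(y,z)$ (resp. $\varphi^{\min}_{<}(y,z)$) is the maximum (resp. minimum), in the lexicographic order on $\mathbb{C}$ (real part first, then imaginary part), of the gains of the shortest paths from $y$ to $z$; $\varphi^{\max}_{<}(z,y)=\overline{\varphi^{\max}_{<}(y,z)}$, likewise for min. $D^{\max}_{<}(\Theta)$ has $(s,t)$ entry $\varphi^{\max}_{<}(v_s,v_t)d(v_s,v_t)$ for $s\ne t$ and $0$ on the diagonal; $D^{\min}_{<}$ similarly. $Tr(\Sigma)=\mathrm{diag}(tr(v_j))$ with $tr(v)=\sum_u d(v,u)$. $DL^{\max}_{<}(\Theta)=Tr(\Sigma)-D^{\max}_{<}(\Theta)$,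 $DL^{\min}_{<}(\Theta)=Tr(\Sigma)-D^{\min}_{<}(\Theta)$. *)

theory Defs
  imports
    "Graph_Theory.Graph_Theory"
    "Jordan_Normal_Form.Char_Poly"
    "HOL-Computational_Algebra.Fundamental_Theorem_Algebra"
begin

text \<open>
  A finite simple graph is represented by its symmetric, loop-free digraph of oriented edges
  (locale \<open>pair_graph\<close>), so that an oriented edge from \<open>u\<close> to \<open>v\<close> is the arc \<open>(u, v)\<close>.
  The values of \<open>\<phi>\<close> outside the arcs are irrelevant.
\<close>

locale gain_graph = pair_graph G for G :: "'a pair_pre_digraph" +
  fixes \<phi> :: "'a \<times> 'a \<Rightarrow> complex"
  assumes gain_unit: "e \<in> parcs G \<Longrightarrow> cmod (\<phi> e) = 1"
    and gain_inverse: "(u, v) \<in> parcs G \<Longrightarrow> \<phi> (v, u) = inverse (\<phi> (u, v))"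

definition gain :: "('a \<times> 'a \<Rightarrow> complex) \<Rightarrow> ('a \<times> 'a) list \<Rightarrow> complex" where
  "gain \<phi> p = prod_list (map \<phi> p)"

text \<open>
  The library notion of a directed cycle also admits the arc lists \<open>[(u, v), (v, u)]\<close>, which are
  not cycles of the underlying simple graph; the length condition excludes them.
\<close>

definition balanced :: "'a pair_pre_digraph \<Rightarrow> ('a \<times> 'a \<Rightarrow> complex) \<Rightarrow> bool" where
  "balanced G \<phi> \<longleftrightarrow>
    (\<forall>c. pre_digraph.cycle (with_proj G) c \<and> length c \<ge> 3 \<longrightarrow> gain \<phi> c = 1)"

definition gdist :: "'a pair_pre_digraph \<Rightarrow> 'a \<Rightarrow> 'a \<Rightarrow> nat" where
  "gdist G u v = (LEAST k. \<exists>p. pre_digraph.apath (with_proj G) u p v \<and> length p = k)"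

definition shortest_paths :: "'a pair_pre_digraph \<Rightarrow> 'a \<Rightarrow> 'a \<Rightarrow> ('a \<times> 'a) list set" where
  "shortest_paths G u v =
    {p. pre_digraph.apath (with_proj G) u p v \<and> length p = gdist G u v}"

definition lex_le :: "complex \<Rightarrow> complex \<Rightarrow> bool" where
  "lex_le z w \<longleftrightarrow> Re z < Re w \<or> (Re z = Re w \<and> Im z \<le> Im w)"

definition lex_max :: "complex set \<Rightarrow> complex" where
  "lex_max A = (THE m. m \<in> A \<and> (\<forall>z\<in>A. lex_le z m))"

definition lex_min :: "complex set \<Rightarrow> complex" where
  "lex_min A = (THE m. m \<in> A \<and> (\<forall>z\<in>A. lex_le m z))"

text \<open>
  The relation \<open>r\<close> is the strict vertex ordering. The two functions below are meant to be used at
  distinct vertices only.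
\<close>

definition gain_max ::
    "'a pair_pre_digraph \<Rightarrow> ('a \<times> 'a \<Rightarrow> complex) \<Rightarrow> 'a rel \<Rightarrow> 'a \<Rightarrow> 'a \<Rightarrow> complex" where
  "gain_max G \<phi> r y z =
    (if (y, z) \<in> r then lex_max (gain \<phi> ` shortest_paths G y z)
     else cnj (lex_max (gain \<phi> ` shortest_paths G z y)))"

definition gain_min ::
    "'a pair_pre_digraph \<Rightarrow> ('a \<times> 'a \<Rightarrow> complex) \<Rightarrow> 'a rel \<Rightarrow> 'a \<Rightarrow> 'a \<Rightarrow> complex" where
  "gain_min G \<phi> r y z =
    (if (y, z) \<in> r then lex_min (gain \<phi> ` shortest_paths G y z)
     else cnj (lex_min (gain \<phi> ` shortest_paths G z y)))"

definition transmission :: "'a pair_pre_digraph \<Rightarrow> 'a \<Rightarrow> nat" where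
  "transmission G v = (\<Sum>u\<in>pverts G. gdist G v u)"

text \<open>
  In the matrices below the vertices are enumerated as \<open>vert 0, \<dots>, vert (n - 1)\<close>; the enumeration
  need not be compatible with the vertex ordering \<open>r\<close>.
\<close>

definition dist_mat :: "'a pair_pre_digraph \<Rightarrow> nat \<Rightarrow> (nat \<Rightarrow> 'a) \<Rightarrow> complex mat" where
  "dist_mat G n vert = mat n n (\<lambda>(s, t). of_nat (gdist G (vert s) (vert t)))"

definition gain_dist_mat_max ::
    "'a pair_pre_digraph \<Rightarrow> ('a \<times> 'a \<Rightarrow> complex) \<Rightarrow> 'a rel \<Rightarrow> nat \<Rightarrow> (nat \<Rightarrow> 'a) \<Rightarrow> complex mat" where
  "gain_dist_mat_max G \<phi> r n vert = mat n n (\<lambda>(s, t).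
    if s = t then 0
    else gain_max G \<phi> r (vert s) (vert t) * of_nat (gdist G (vert s) (vert t)))"

definition gain_dist_mat_min ::
    "'a pair_pre_digraph \<Rightarrow> ('a \<times> 'a \<Rightarrow> complex) \<Rightarrow> 'a rel \<Rightarrow> nat \<Rightarrow> (nat \<Rightarrow> 'a) \<Rightarrow> complex mat" where
  "gain_dist_mat_min G \<phi> r n vert = mat n n (\<lambda>(s, t).
    if s = t then 0
    else gain_min G \<phi> r (vert s) (vert t) * of_nat (gdist G (vert s) (vert t)))"

definition transmission_mat :: "'a pair_pre_digraph \<Rightarrow> nat \<Rightarrow> (nat \<Rightarrow> 'a) \<Rightarrow> complex mat" where
  "transmission_mat G n vert = mat n n (\<lambda>(s, t).
    if s = t then of_nat (transmission G (vert s)) else 0)"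

definition dist_laplacian :: "'a pair_pre_digraph \<Rightarrow> nat \<Rightarrow> (nat \<Rightarrow> 'a) \<Rightarrow> complex mat" where
  "dist_laplacian G n vert = transmission_mat G n vert - dist_mat G n vert"

definition gain_dist_laplacian_max ::
    "'a pair_pre_digraph \<Rightarrow> ('a \<times> 'a \<Rightarrow> complex) \<Rightarrow> 'a rel \<Rightarrow> nat \<Rightarrow> (nat \<Rightarrow> 'a) \<Rightarrow> complex mat" where
  "gain_dist_laplacian_max G \<phi> r n vert =
    transmission_mat G n vert - gain_dist_mat_max G \<phi> r n vert"

definition gain_dist_laplacian_min ::
    "'a pair_pre_digraph \<Rightarrow> ('a \<times> 'a \<Rightarrow> complex) \<Rightarrow> 'a rel \<Rightarrow> nat \<Rightarrow> (nat \<Rightarrow> 'a) \<Rightarrow> complex mat" where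
  "gain_dist_laplacian_min G \<phi> r n vert =
    transmission_mat G n vert - gain_dist_mat_min G \<phi> r n vert"

text \<open>The spectrum is the multiset of eigenvalues, counted with algebraic multiplicity.\<close>

definition mspectrum :: "complex mat \<Rightarrow> complex multiset" where
  "mspectrum A = proots (char_poly A)"

end

theory Submission
  imports Defs
begin

text \<open>
  If the gain graph is balanced, every closed walk has gain 1, so the gain of a walk from \<open>u\<close> to
  \<open>v\<close> is \<open>h u / h v\<close> for a potential \<open>h\<close>. All shortest paths between two vertices then have the
  same gain, and conjugation by \<open>diag h\<close> turns the distance Laplacian of the underlying graph into
  that of the gain graph.

  Conversely, the all-ones vector shows that 0 is an eigenvalue of the distance Laplacian of the
  underlying graph, so the gain distance Laplacian has a nonzero kernel vector \<open>x\<close>. The triangle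
  inequality at an entry of maximal modulus is an equality, which forces all entries to have the
  same modulus and then \<open>x\<close> to be a potential for the gains; hence all cycles have gain 1.
\<close>

section \<open>Gains of arc lists and lexicographic extrema\<close>

lemma gain_Nil [simp]: "gain \<phi> [] = 1"
  and gain_Cons [simp]: "gain \<phi> (e # p) = \<phi> e * gain \<phi> p"
  and gain_append [simp]: "gain \<phi> (p @ q) = gain \<phi> p * gain \<phi> q"
  by (auto simp: gain_def)

lemma lex_max_singleton [simp]: "lex_max {z} = z"
  and lex_min_singleton [simp]: "lex_min {z} = z"
  by (auto simp: lex_max_def lex_min_def lex_le_def)

text \<open>The description in \<open>lex_max\<close> denotes only if a greatest element exists and
  is unique: totality of \<open>lex_le\<close> gives existence by induction on the finite set,
  antisymmetry gives uniqueness.\<close>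

lemma lex_max_in:
  assumes "finite A" "A \<noteq> {}"
  shows "lex_max A \<in> A"
proof -
  have "\<exists>m\<in>A. \<forall>z\<in>A. lex_le z m"
    using assms
  proof (induction A rule: finite_ne_induct)
    case (singleton x)
    then show ?case by (auto simp: lex_le_def)
  next
    case (insert x F)
    then obtain m where m: "m \<in> F" "\<forall>z\<in>F. lex_le z m" by auto
    show ?case
    proof (cases "lex_le x m")
      case True
      then show ?thesis using m by auto
    next
      case False
      then have "\<forall>z\<in>F. lex_le z x" "lex_le x x"
        using m unfolding lex_le_def by force+
      then show ?thesis by auto
    qed
  qed
  then obtain m where m: "m \<in> A" "\<forall>z\<in>A. lex_le z m" by auto
  have "lex_max A = m"
    unfolding lex_max_def
  proof (rule the_equality)
    show "m \<in> A \<and> (\<forall>z\<in>A. lex_le z m)" using m by simp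
    show "m' = m" if "m' \<in> A \<and> (\<forall>z\<in>A. lex_le z m')" for m'
    proof -
      have "lex_le m m'" "lex_le m' m" using that m by auto
      then show ?thesis by (auto simp: lex_le_def complex_eq_iff)
    qed
  qed
  with m show ?thesis by simp
qed

section \<open>Spectra and Laplacian-type matrices\<close>

lemma mspectrum_diagonal_conjugate:
  fixes c :: "nat \<Rightarrow> complex"
  assumes A: "A \<in> carrier_mat n n" and B: "B \<in> carrier_mat n n"
    and c: "\<And>i. i < n \<Longrightarrow> c i \<noteq> 0"
    and AB: "\<And>i j. i < n \<Longrightarrow> j < n \<Longrightarrow> A $$ (i, j) = c i * B $$ (i, j) / c j"
  shows "mspectrum A = mspectrum B"
proof -
  define P where "P = mat n n (\<lambda>(i, j). if i = j then c i else 0)"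
  define Q where "Q = mat n n (\<lambda>(i, j). if i = j then inverse (c i) else 0)"
  have P: "P \<in> carrier_mat n n" and Q: "Q \<in> carrier_mat n n"
    by (auto simp: P_def Q_def)
  have PQ: "P * Q = 1\<^sub>m n"
    by (rule eq_matI)
      (auto simp: P_def Q_def scalar_prod_def c if_distrib[of "\<lambda>x. x * _"] sum.delta cong: if_cong)
  have QP: "Q * P = 1\<^sub>m n"
    by (rule eq_matI)
      (auto simp: P_def Q_def scalar_prod_def c if_distrib[of "\<lambda>x. x * _"] sum.delta cong: if_cong)
  have PB: "P * B = mat n n (\<lambda>(i, j). c i * B $$ (i, j))"
    using B by (intro eq_matI)
      (auto simp: P_def scalar_prod_def if_distrib[of "\<lambda>x. x * _"] sum.delta cong: if_cong)
  have "A = P * B * Q"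
    unfolding PB using A AB
    by (intro eq_matI)
      (auto simp: Q_def scalar_prod_def if_distrib[of "\<lambda>x. _ * x"] sum.delta divide_inverse
        cong: if_cong)
  then have "similar_mat_wit A B P Q"
    using A B P Q PQ QP by (simp add: similar_mat_wit_def Let_def)
  then have "similar_mat A B"
    unfolding similar_mat_def by blast
  then show ?thesis
    by (simp add: mspectrum_def char_poly_similar)
qed

lemma in_mspectrum_iff:
  assumes "A \<in> carrier_mat n n"
  shows "k \<in># mspectrum A \<longleftrightarrow> eigenvalue A k"
proof -
  \<comment> \<open>\<open>proots\<close> describes the set of zeros only for a nonzero polynomial;
    a characteristic polynomial is monic.\<close>
  have "char_poly A \<noteq> 0"
    using degree_monic_char_poly[OF assms] by auto
  then show ?thesis
    by (simp add: mspectrum_def eigenvalue_root_char_poly[OF assms])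
qed

text \<open>The diagonal entry is split into its summands, each paired with the off-diagonal term of
  the same index. It serves the underlying graph with \<open>g = 1\<close> and the gain graph with
  its unit gains.\<close>

lemma laplacian_mult_vec:
  fixes A :: "complex mat" and d g :: "nat \<Rightarrow> complex"
  assumes "A \<in> carrier_mat n n" "v \<in> carrier_vec n" "i < n"
    and diag: "A $$ (i, i) = (\<Sum>j\<in>{..<n} - {i}. d j)"
    and off: "\<And>j. j < n \<Longrightarrow> j \<noteq> i \<Longrightarrow> A $$ (i, j) = - (g j * d j)"
  shows "(A *\<^sub>v v) $ i = (\<Sum>j\<in>{..<n} - {i}. d j * (v $ i - g j * v $ j))"
proof -
  have "(A *\<^sub>v v) $ i = (\<Sum>j<n. A $$ (i, j) * v $ j)"
    using assms(1-3) by (simp add: scalar_prod_def atLeast0LessThan)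
  also have "\<dots> = A $$ (i, i) * v $ i + (\<Sum>j\<in>{..<n} - {i}. A $$ (i, j) * v $ j)"
    using assms(3) by (intro sum.remove) auto
  also have "\<dots> = (\<Sum>j\<in>{..<n} - {i}. d j * v $ i + A $$ (i, j) * v $ j)"
    by (simp add: diag sum_distrib_right sum.distrib)
  also have "\<dots> = (\<Sum>j\<in>{..<n} - {i}. d j * (v $ i - g j * v $ j))"
    by (intro sum.cong) (auto simp: off algebra_simps)
  finally show ?thesis .
qed

section \<open>The maximum principle for kernel vectors\<close>

lemma cnj_eq_inverse_if_norm_1: "cmod z = 1 \<Longrightarrow> cnj z = inverse z"
  using complex_div_cnj[of 1 z] by (simp add: divide_inverse)

text \<open>This is the equality case of Cauchy-Schwarz in the plane: expanding the square of
  \<open>cmod (w - z)\<close> shows that it is at most 0.\<close>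

lemma eq_if_Re_cnj_mult_ge:
  fixes w z :: complex
  assumes "cmod w \<le> cmod z" "(cmod z)\<^sup>2 \<le> Re (cnj z * w)"
  shows "w = z"
proof -
  have "(cmod (w - z))\<^sup>2 = (cmod w)\<^sup>2 + (cmod z)\<^sup>2 - 2 * Re (cnj z * w)"
    by (simp only: cmod_power2) (simp add: power2_eq_square algebra_simps)
  also have "\<dots> \<le> 0"
    using assms(2) power_mono[OF assms(1) norm_ge_zero, of 2] by linarith
  finally show ?thesis by simp
qed

text \<open>The maximum principle: at an index where the modulus of \<open>x\<close> is maximal, all terms of the
  sum, multiplied by the conjugate of \<open>x k\<close>, have nonnegative real part and hence vanish.\<close>

lemma kernel_switching:
  fixes x :: "nat \<Rightarrow> complex" and g :: "nat \<Rightarrow> nat \<Rightarrow> complex" and d :: "nat \<Rightarrow> nat \<Rightarrow> real"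
  assumes d: "\<And>i j. i < n \<Longrightarrow> j < n \<Longrightarrow> i \<noteq> j \<Longrightarrow> d i j > 0"
    and g: "\<And>i j. i < n \<Longrightarrow> j < n \<Longrightarrow> i \<noteq> j \<Longrightarrow> cmod (g i j) = 1"
    and ker: "\<And>i. i < n \<Longrightarrow> (\<Sum>j\<in>{..<n} - {i}. of_real (d i j) * (x i - g i j * x j)) = 0"
    and ij: "i < n" "j < n" "i \<noteq> j"
  shows "g i j * x j = x i"
proof -
  have max_eq: "g k l * x l = x k"
    if k: "k < n" and max: "\<And>m. m < n \<Longrightarrow> cmod (x m) \<le> cmod (x k)"
      and l: "l < n" "k \<noteq> l" for k l
  proof -
    have le: "cmod (g k m * x m) \<le> cmod (x k)" if "m \<in> {..<n} - {k}" for m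
      using that g[of k m] max[of m] k by (simp add: norm_mult)
    define t where "t = (\<lambda>m. d k m * ((cmod (x k))\<^sup>2 - Re (cnj (x k) * (g k m * x m))))"
    have nonneg: "t m \<ge> 0" if "m \<in> {..<n} - {k}" for m
    proof -
      have "Re (cnj (x k) * (g k m * x m)) \<le> cmod (cnj (x k) * (g k m * x m))"
        by (rule complex_Re_le_cmod)
      also have "\<dots> \<le> cmod (x k) * cmod (x k)"
        unfolding norm_mult[of "cnj (x k)"] complex_mod_cnj using le[OF that]
        by (intro mult_left_mono) auto
      finally show ?thesis
        using d[of k m] k that by (simp add: t_def power2_eq_square)
    qed
    have "t m = Re (cnj (x k) * (of_real (d k m) * (x k - g k m * x m)))" for m
      unfolding t_def cmod_power2 by (simp add: power2_eq_square algebra_simps)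
    then have "sum t ({..<n} - {k})
        = Re (cnj (x k) * (\<Sum>m\<in>{..<n} - {k}. of_real (d k m) * (x k - g k m * x m)))"
      unfolding sum_distrib_left Re_sum by (rule sum.cong[OF refl])
    also have "\<dots> = 0"
      by (simp only: ker[OF k]) simp
    finally have "t l = 0"
      using sum_nonneg_eq_0_iff[of "{..<n} - {k}" t] nonneg l by auto
    then have "(cmod (x k))\<^sup>2 \<le> Re (cnj (x k) * (g k l * x l))"
      using d[of k l] k l by (simp add: t_def)
    then show ?thesis
      using le[of l] l by (intro eq_if_Re_cnj_mult_ge) auto
  qed
  have "finite ((\<lambda>m. cmod (x m)) ` {..<n})" "(\<lambda>m. cmod (x m)) ` {..<n} \<noteq> {}"
    using ij by auto
  from Max_in[OF this] obtain k where "k < n" "Max ((\<lambda>m. cmod (x m)) ` {..<n}) = cmod (x k)"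
    by auto
  then have k: "k < n" "\<And>m. m < n \<Longrightarrow> cmod (x m) \<le> cmod (x k)"
    using Max_ge[of "(\<lambda>m. cmod (x m)) ` {..<n}"] by auto
  \<comment> \<open>The factors \<open>g k m\<close> are unimodular, so \<open>max_eq\<close> at one
    maximal index makes every index maximal. It can then be applied at \<open>i\<close>
    itself.\<close>
  have eq: "cmod (x m) = cmod (x k)" if "m < n" for m
  proof (cases "m = k")
    case False
    then have "cmod (g k m) * cmod (x m) = cmod (x k)"
      using max_eq[OF k that] by (metis norm_mult)
    then show ?thesis using g[of k m] k(1) that False by simp
  qed simp
  show ?thesis
    using ij(1) k(2)[folded eq[OF ij(1)]] ij(2,3) by (rule max_eq)
qed

section \<open>Balance, closed walks and potentials\<close>

context gain_graph
begin

lemma gain_nonzero: "e \<in> parcs G \<Longrightarrow> \<phi> e \<noteq> 0"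
  using gain_unit[of e] by auto

lemma cmod_gain_awalk: "awalk u p v \<Longrightarrow> cmod (gain \<phi> p) = 1"
  by (induction p arbitrary: u) (auto simp: awalk_Cons_iff norm_mult gain_unit)

text \<open>The short cycles left out of \<open>balanced\<close> are harmless: length 1 would be a
  loop, and length 2 traverses an edge back and forth, so its gains cancel.\<close>

lemma balanced_gain_cycle:
  assumes "balanced G \<phi>" "cycle c"
  shows "gain \<phi> c = 1"
proof (cases "length c \<ge> 3")
  case True
  then show ?thesis using assms by (auto simp: balanced_def)
next
  case False
  obtain u where u: "awalk u c u" "c \<noteq> []" using assms(2) by (auto simp: cycle_def)
  have len: "length c = 1 \<or> length c = 2"
    using False u(2) length_0_conv[of c] by linarith
  show ?thesis
  proof (cases "length c = 1")
    case True
    then obtain e where "c = [e]" by (auto simp: length_Suc_conv)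
    then show ?thesis using u no_loops' by (cases e) (auto simp: awalk_simps)
  next
    case False
    then obtain e f where "c = [e, f]" using len by (auto simp: length_Suc_conv numeral_2_eq_2)
    then have e: "e \<in> parcs G" and "f = (snd e, fst e)"
      using u by (auto simp: awalk_simps prod_eq_iff)
    then have "\<phi> f = inverse (\<phi> e)"
      using gain_inverse[of "fst e" "snd e"] by simp
    with e show ?thesis using gain_nonzero \<open>c = [e, f]\<close> by simp
  qed
qed

text \<open>Strong induction on the length: if the tail after the first arc repeats no vertex, the
  walk is a cycle; otherwise a closed subwalk can be cut out of the tail.\<close>

lemma balanced_gain_closed:
  assumes "balanced G \<phi>" "awalk u p u"
  shows "gain \<phi> p = 1"
  using assms(2)
proof (induction "length p" arbitrary: u p rule: less_induct)
  case less
  show ?case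
  proof (cases p)
    case Nil
    then show ?thesis by simp
  next
    case (Cons e p')
    then have e: "e \<in> parcs G" "fst e = u" "awalk (snd e) p' u"
      using less.prems by (auto simp: awalk_Cons_iff)
    show ?thesis
    proof (cases "distinct (awalk_verts (snd e) p')")
      case True
      then have "cycle p"
        using less.prems Cons unfolding cycle_def by auto
      then show ?thesis using balanced_gain_cycle assms(1) by blast
    next
      case False
      obtain q r s w where w: "p' = q @ r @ s" "awalk (snd e) q w" "awalk w r w" "awalk w s u"
        and "closed_w r"
        using awalk_cyc_decompE'[OF e(3) False] by metis
      \<comment> \<open>Nonemptiness of \<open>r\<close> makes the remaining walk shorter, and the
        leading arc \<open>e\<close> makes \<open>r\<close> shorter than \<open>p\<close>; both fall
        under the induction hypothesis.\<close>
      then have "r \<noteq> []"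
        by (auto simp: closed_w_def)
      have "gain \<phi> r = 1"
        using less.hyps[OF _ w(3)] Cons w by simp
      moreover have "awalk u (e # q @ s) u"
        using e w by (auto simp: awalk_Cons_iff)
      then have "gain \<phi> (e # q @ s) = 1"
        using less.hyps[of "e # q @ s" u] Cons w \<open>r \<noteq> []\<close> by simp
      ultimately show ?thesis using Cons w by simp
    qed
  qed
qed

text \<open>Along a walk the arc equations telescope to \<open>gain \<phi> p * h v = h u\<close>; on
  a closed walk the nonzero factor \<open>h u\<close> cancels.\<close>

lemma balanced_if_potential:
  assumes "\<And>v. v \<in> pverts G \<Longrightarrow> h v \<noteq> 0"
    and "\<And>u v. (u, v) \<in> parcs G \<Longrightarrow> \<phi> (u, v) * h v = h u"
  shows "balanced G \<phi>"
proof -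
  have walk: "gain \<phi> p * h v = h u" if "awalk u p v" for u p v
    using that
  proof (induction p arbitrary: u)
    case Nil
    then show ?case by (auto simp: awalk_simps)
  next
    case (Cons e p)
    then have "gain \<phi> p * h v = h (snd e)" "\<phi> e * h (snd e) = h u"
      using assms(2)[of "fst e" "snd e"] by (auto simp: awalk_Cons_iff)
    then show ?case by (simp add: mult.assoc)
  qed
  show ?thesis
    unfolding balanced_def
  proof (intro allI impI, elim conjE)
    fix c assume "cycle c"
    then obtain u where u: "awalk u c u" by (auto simp: cycle_def)
    then have "u \<in> pverts G" by auto
    then show "gain \<phi> c = 1" using walk[OF u] assms(1) by auto
  qed
qed

section \<open>Distances and shortest paths\<close>

lemma gdist_self [simp]: "v \<in> pverts G \<Longrightarrow> gdist G v v = 0"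
  unfolding gdist_def by (rule Least_eq_0) (auto simp: apath_Nil_iff)

lemma shortest_paths_awalk: "p \<in> shortest_paths G u v \<Longrightarrow> awalk u p v"
  by (auto simp: shortest_paths_def apath_def)

lemma finite_shortest_paths: "finite (shortest_paths G u v)"
  unfolding shortest_paths_def by (rule finite_subset[OF _ apaths_finite[of u v]]) auto

lemma shortest_paths_arc:
  assumes "(u, v) \<in> parcs G"
  shows "shortest_paths G u v = {[(u, v)]}"
proof -
  have neq: "u \<noteq> v" using no_loops' assms by auto
  have arc: "apath u [(u, v)] v"
    using assms neq by (auto simp: apath_simps dest: in_arcsD2)
  have "gdist G u v = 1"
    unfolding gdist_def
  proof (rule Least_equality)
    show "\<exists>p. apath u p v \<and> length p = 1" using arc by force
    show "1 \<le> k" if "\<exists>p. apath u p v \<and> length p = k" for k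
      using that neq by (cases k) (auto simp: apath_simps)
  qed
  then show ?thesis
    using arc by (auto simp: shortest_paths_def length_Suc_conv apath_simps)
qed

text \<open>The only shortest path between adjacent vertices is the arc. The order \<open>r\<close>
  does not matter, since reversing the arc inverts its gain and conjugation inverts unit
  numbers.\<close>

lemma gain_max_arc:
  assumes "(u, v) \<in> parcs G"
  shows "gain_max G \<phi> r u v = \<phi> (u, v)"
proof -
  have vu: "(v, u) \<in> parcs G" using assms by (rule arcs_symmetric)
  have "cnj (\<phi> (v, u)) = \<phi> (u, v)"
    using gain_inverse[OF vu] gain_unit[OF vu] by (simp add: cnj_eq_inverse_if_norm_1)
  then show ?thesis
    using assms vu by (simp add: gain_max_def shortest_paths_arc)
qed

end

section \<open>Connected gain graphs and the potential of a balanced one\<close>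

locale connected_gain_graph = gain_graph +
  assumes conn: "Digraph_Component.connected (with_proj G)"
begin

lemma shortest_paths_nonempty:
  assumes "u \<in> pverts G" "v \<in> pverts G"
  shows "shortest_paths G u v \<noteq> {}"
proof -
  have "strongly_connected (with_proj G)"
    using symmetric_connected_imp_strongly_connected[OF _ conn] pair_sym_arcs by simp
  then have "\<exists>p. apath u p v"
    using assms by (auto simp: strongly_connected_def reachable_apath)
  then have "\<exists>k p. apath u p v \<and> length p = k" by blast
  from LeastI_ex[OF this] show ?thesis
    by (auto simp: shortest_paths_def gdist_def)
qed

lemma gdist_pos:
  assumes "u \<in> pverts G" "v \<in> pverts G" "u \<noteq> v"
  shows "gdist G u v > 0"
  using shortest_paths_nonempty[OF assms(1,2)] assms(3)
  by (auto simp: shortest_paths_def apath_Nil_iff intro!: Nat.gr0I)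

lemma cmod_gain_max:
  assumes "u \<in> pverts G" "v \<in> pverts G"
  shows "cmod (gain_max G \<phi> r u v) = 1"
proof -
  have "cmod (lex_max (gain \<phi> ` shortest_paths G y z)) = 1"
    if "y \<in> pverts G" "z \<in> pverts G" for y z
    using lex_max_in[of "gain \<phi> ` shortest_paths G y z"] finite_shortest_paths
      shortest_paths_nonempty[OF that]
    by (auto dest!: shortest_paths_awalk simp: cmod_gain_awalk)
  then show ?thesis using assms by (simp add: gain_max_def)
qed

text \<open>The potential at \<open>v\<close> is the gain of a chosen walk from \<open>v\<close> to
  a fixed base vertex. All shortest paths between two vertices then have one common gain, so maximum
  and minimum coincide.\<close>

lemma balanced_potentialE:
  assumes "balanced G \<phi>"
  obtains h where "\<And>v. v \<in> pverts G \<Longrightarrow> cmod (h v) = 1"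
    and "\<And>u v r. u \<in> pverts G \<Longrightarrow> v \<in> pverts G \<Longrightarrow> gain_max G \<phi> r u v = h u / h v"
    and "\<And>u v r. u \<in> pverts G \<Longrightarrow> v \<in> pverts G \<Longrightarrow> gain_min G \<phi> r u v = h u / h v"
proof (cases "pverts G = {}")
  case True
  then show ?thesis using that[of "\<lambda>_. 1"] by auto
next
  case False
  then obtain x where x: "x \<in> pverts G" by auto
  define w where "w = (\<lambda>v. SOME p. p \<in> shortest_paths G v x)"
  define h where "h = (\<lambda>v. gain \<phi> (w v))"
  have w: "awalk v (w v) x" if "v \<in> pverts G" for v
    using someI_ex[of "\<lambda>p. p \<in> shortest_paths G v x"] shortest_paths_nonempty[OF that x]
    by (auto simp: w_def intro: shortest_paths_awalk)
  then have h: "cmod (h v) = 1" if "v \<in> pverts G" for v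
    using that cmod_gain_awalk by (auto simp: h_def)
  have walk: "gain \<phi> p = h u / h v" if p: "awalk u p v" for u p v
  proof -
    have uv: "u \<in> pverts G" "v \<in> pverts G" using p by auto
    obtain q where q: "awalk x q u"
      using shortest_paths_nonempty[OF x uv(1)] by (auto dest: shortest_paths_awalk)
    \<comment> \<open>Two closed walks through \<open>u\<close> are compared: after
      \<open>q\<close>, one returns to \<open>x\<close> via \<open>p\<close> and \<open>v\<close>,
      the other directly.\<close>
    have "awalk x (q @ p @ w v) x" "awalk x (q @ w u) x"
      using q p w uv by auto
    then have "gain \<phi> (q @ p @ w v) = 1" "gain \<phi> (q @ w u) = 1"
      using balanced_gain_closed[OF assms] by blast+
    then have "gain \<phi> q * (gain \<phi> p * h v) = gain \<phi> q * h u" "gain \<phi> q \<noteq> 0"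
      by (auto simp: h_def)
    then have "gain \<phi> p * h v = h u" by simp
    moreover have "h v \<noteq> 0" using h uv by force
    ultimately show ?thesis by (simp add: field_simps)
  qed
  have img: "gain \<phi> ` shortest_paths G u v = {h u / h v}" if "u \<in> pverts G" "v \<in> pverts G" for u v
  proof -
    have "gain \<phi> p = h u / h v" if "p \<in> shortest_paths G u v" for p
      using that by (intro walk shortest_paths_awalk)
    then show ?thesis
      using shortest_paths_nonempty[OF that] by (auto simp: image_iff)
  qed
  \<comment> \<open>This covers pairs outside \<open>r\<close>, whose gain is the conjugate of that
    of the reversed pair.\<close>
  have cnj: "cnj (h v / h u) = h u / h v" if "u \<in> pverts G" "v \<in> pverts G" for u v
    using h[OF that(1)] h[OF that(2)] by (simp add: cnj_eq_inverse_if_norm_1 field_simps)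
  show ?thesis
  proof (rule that[of h])
    fix u v r assume uv: "u \<in> pverts G" "v \<in> pverts G"
    show "gain_max G \<phi> r u v = h u / h v" "gain_min G \<phi> r u v = h u / h v"
      unfolding gain_max_def gain_min_def img[OF uv] img[OF uv(2,1)]
        lex_max_singleton lex_min_singleton cnj[OF uv] by simp_all
  qed (rule h)
qed

end

section \<open>Balance and the spectrum of the distance Laplacian\<close>

theorem theorem13:
  fixes G :: "'a pair_pre_digraph" and \<phi> :: "'a \<times> 'a \<Rightarrow> complex"
    and r :: "'a rel" and n :: nat and vert :: "nat \<Rightarrow> 'a"
  assumes "gain_graph G \<phi>"
    and "Digraph_Component.connected (with_proj G)"
    and "bij_betw vert {..<n} (pverts G)"
    and "strict_linear_order_on (pverts G) r"
  shows "balanced G \<phi> \<longleftrightarrow>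
    gain_dist_laplacian_max G \<phi> r n vert = gain_dist_laplacian_min G \<phi> r n vert \<and>
    mspectrum (gain_dist_laplacian_max G \<phi> r n vert) = mspectrum (dist_laplacian G n vert)"
proof -
  interpret gain_graph G \<phi> by fact
  interpret connected_gain_graph G \<phi>
    using assms(2) by unfold_locales
  let ?d = "\<lambda>i j. gdist G (vert i) (vert j)"
  let ?L = "gain_dist_laplacian_max G \<phi> r n vert"
  let ?M = "gain_dist_laplacian_min G \<phi> r n vert"
  let ?D = "dist_laplacian G n vert"
  have vert: "vert i \<in> pverts G" if "i < n" for i
    using assms(3) that by (auto simp: bij_betw_def)
  have inj: "vert i \<noteq> vert j" if "i < n" "j < n" "i \<noteq> j" for i j
    using assms(3) that by (auto simp: bij_betw_def inj_on_def)
  have L: "?L \<in> carrier_mat n n" and M: "?M \<in> carrier_mat n n" and D: "?D \<in> carrier_mat n n"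
    by (auto simp: gain_dist_laplacian_max_def gain_dist_laplacian_min_def dist_laplacian_def
        transmission_mat_def gain_dist_mat_max_def gain_dist_mat_min_def dist_mat_def)
  have L_entry: "?L $$ (i, j) = (if i = j then of_nat (transmission G (vert i))
      else - (gain_max G \<phi> r (vert i) (vert j) * of_nat (?d i j)))" if "i < n" "j < n" for i j
    using that
    by (simp add: gain_dist_laplacian_max_def transmission_mat_def gain_dist_mat_max_def)
  have M_entry: "?M $$ (i, j) = (if i = j then of_nat (transmission G (vert i))
      else - (gain_min G \<phi> r (vert i) (vert j) * of_nat (?d i j)))" if "i < n" "j < n" for i j
    using that
    by (simp add: gain_dist_laplacian_min_def transmission_mat_def gain_dist_mat_min_def)
  \<comment> \<open>\<open>dist_mat\<close> has no separate diagonal case; its diagonal vanishes by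
    \<open>gdist_self\<close>, applied to the vertex \<open>vert i\<close>.\<close>
  have D_entry: "?D $$ (i, j) = (if i = j then of_nat (transmission G (vert i))
      else - of_nat (?d i j))" if "i < n" "j < n" for i j
    using that by (simp add: dist_laplacian_def transmission_mat_def dist_mat_def vert)
  show ?thesis
  proof (intro iffI, goal_cases)
    case 1
    then obtain h where h: "\<And>v. v \<in> pverts G \<Longrightarrow> cmod (h v) = 1"
      and max: "\<And>u v r. u \<in> pverts G \<Longrightarrow> v \<in> pverts G \<Longrightarrow> gain_max G \<phi> r u v = h u / h v"
      and min: "\<And>u v r. u \<in> pverts G \<Longrightarrow> v \<in> pverts G \<Longrightarrow> gain_min G \<phi> r u v = h u / h v"
      using balanced_potentialE by blast
    have h0: "h (vert i) \<noteq> 0" if "i < n" for i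
      using h[OF vert[OF that]] by auto
    have "?L = ?M"
      using L M by (intro eq_matI) (auto simp: L_entry M_entry max min vert)
    \<comment> \<open>The conjugating diagonal has the entries \<open>h (vert i)\<close>, fixed by
      unification with \<open>h0\<close>.\<close>
    moreover have "mspectrum ?L = mspectrum ?D"
      using L D h0
      by (rule mspectrum_diagonal_conjugate) (auto simp: L_entry D_entry max vert h0)
    ultimately show ?case by simp
  next
    case 2
    have trans: "of_nat (transmission G (vert i)) = (\<Sum>j\<in>{..<n} - {i}. of_nat (?d i j) :: complex)"
      if "i < n" for i
    proof -
      have "transmission G (vert i) = (\<Sum>j<n. ?d i j)"
        unfolding transmission_def by (rule sum.reindex_bij_betw[OF assms(3), symmetric])
      also have "\<dots> = (\<Sum>j\<in>{..<n} - {i}. ?d i j)"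
        using that vert by (subst sum.remove[of _ i]) auto
      finally show ?thesis by simp
    qed
    \<comment> \<open>Connectedness includes a nonempty vertex set, so the all-ones vector is not
      zero. It lies in the kernel because each transmission is a row sum of distances.\<close>
    have "n \<noteq> 0"
      using assms(2,3) by (auto simp: connected_def strongly_connected_def bij_betw_def)
    have "eigenvector ?D (vec n (\<lambda>_. 1)) 0"
      unfolding eigenvector_def
    proof (intro conjI)
      show "vec n (\<lambda>_. 1) \<noteq> (0\<^sub>v (dim_row ?D) :: complex vec)"
        using D \<open>n \<noteq> 0\<close> by (auto simp: vec_eq_iff)
      show "?D *\<^sub>v vec n (\<lambda>_. 1) = 0 \<cdot>\<^sub>v vec n (\<lambda>_. 1)"
      proof (rule eq_vecI)
        fix i assume "i < dim_vec (0 \<cdot>\<^sub>v vec n (\<lambda>_. 1) :: complex vec)"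
        then have i: "i < n" by simp
        have "(?D *\<^sub>v vec n (\<lambda>_. 1)) $ i = (\<Sum>j\<in>{..<n} - {i}.
            of_nat (?d i j) * (vec n (\<lambda>_. 1) $ i - 1 * vec n (\<lambda>_. 1) $ j))"
          using D i by (intro laplacian_mult_vec) (auto simp: D_entry trans)
        then show "(?D *\<^sub>v vec n (\<lambda>_. 1)) $ i = (0 \<cdot>\<^sub>v vec n (\<lambda>_. 1)) $ i"
          using i by simp
      qed (use D in auto)
    qed (use D in auto)
    then have "eigenvalue ?D 0"
      unfolding eigenvalue_def by blast
    then have "eigenvalue ?L 0"
      using 2 in_mspectrum_iff[OF D] in_mspectrum_iff[OF L] by metis
    then obtain x where x: "x \<in> carrier_vec n" "x \<noteq> 0\<^sub>v n" "?L *\<^sub>v x = 0 \<cdot>\<^sub>v x"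
      using L by (auto simp: eigenvalue_def eigenvector_def)
    let ?g = "\<lambda>i j. gain_max G \<phi> r (vert i) (vert j)"
    have switch: "?g i j * x $ j = x $ i" if "i < n" "j < n" "i \<noteq> j" for i j
    proof (rule kernel_switching[of n "\<lambda>i j. real (?d i j)" ?g "\<lambda>i. x $ i", OF _ _ _ that])
      show "(\<Sum>j\<in>{..<n} - {i}. of_real (real (?d i j)) * (x $ i - ?g i j * x $ j)) = 0"
        if "i < n" for i
      proof -
        have "(?L *\<^sub>v x) $ i = (\<Sum>j\<in>{..<n} - {i}. of_nat (?d i j) * (x $ i - ?g i j * x $ j))"
          using L x that by (intro laplacian_mult_vec) (auto simp: L_entry trans)
        then show ?thesis using x that by simp
      qed
    qed (use vert inj gdist_pos cmod_gain_max in auto)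
    obtain m where m: "m < n" "x $ m \<noteq> 0"
      using x(1,2) by (auto simp: vec_eq_iff)
    \<comment> \<open>Switching carries the nonzero entry at \<open>m\<close> to every index,
      because all pairs of distinct indices are linked, not only adjacent ones.\<close>
    have nonzero: "x $ i \<noteq> 0" if "i < n" for i
      using switch[of m i] m that by (cases "i = m") auto
    define k where "k = the_inv_into {..<n} vert"
    have k: "k v < n" "vert (k v) = v" if "v \<in> pverts G" for v
      using assms(3) that the_inv_into_into[of vert "{..<n}" v] f_the_inv_into_f[of vert "{..<n}" v]
      by (auto simp: k_def bij_betw_def)
    show ?case
    \<comment> \<open>The kernel vector, read on vertices through \<open>k\<close>, is the
      potential: on arcs \<open>gain_max\<close> is \<open>\<phi>\<close>, so \<open>switch\<close>
      becomes the arc equation.\<close>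
    proof (rule balanced_if_potential[where h = "\<lambda>v. x $ k v"])
      show "x $ k v \<noteq> 0" if "v \<in> pverts G" for v
        using nonzero k that by simp
      show "\<phi> (u, v) * x $ k v = x $ k u" if "(u, v) \<in> parcs G" for u v
      proof -
        have "u \<in> pverts G" "v \<in> pverts G" "u \<noteq> v"
          using that in_arcsD1 in_arcsD2 no_loops' by auto
        then show ?thesis
          using switch[of "k u" "k v"] k[of u] k[of v] gain_max_arc[OF that] by metis
      qed
    qed
  qed
qed

end
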